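(* Every term of the star combinatory calculus for arithmetic is reducible.
   Context: Star combinatory calculus for arithmetic: types are generated from the ground type $N$ by $\sigma\to\tau$ and $\sigma^*$ ($\to$ associating to the right; every type has the form $\sigma_1\to\cdots\to\sigma_n\to\rho$ with $\rho$ equal to $N$ or a star type). Constants: $0:N$, $S:N\to N$, $R_\sigma:N\to\sigma\to(\sigma\to N\to\sigma)\to\sigma$ for each type $\sigma$; $\Pi_{\sigma,\tau}:\sigma\to\tau\to\sigma$; $\Sigma_{\rho,\sigma,\tau}:(\rho\to\sigma\to\tau)\to(\rho\to\sigma)\to\rho\to\tau$; $\mathfrak{s}_\sigma:\sigma\to\sigma^*$; $\cup_\sigma:\sigma^*\to\sigma^*\to\sigma^*$; $\bigcup_{\sigma,\tau}:\sigma^*\to(\sigma\to\tau^* )\to\tau^*$. Terms: constants, typed variables, applications. Conversions: $\Sigma tqr\rightsquigarrow tr(qr)$; $\Pi tq\rightsquigarrow t$; $\bigcup(\mathfrak{s}t)q\rightsquigarrow qt$; $\bigcup(\cup tq)r\rightsquigarrow\cup(\bigcup tr)(\bigcup qr)$; $R0qr\rightsquigarrow q$; $R(St)qr\rightsquigarrow r(Rtqr)t$. A one-step reduction $t\succ_1 q$ replaces a subterm by its converse according to one conversion; $t\succeq q$ means a finite (possibly empty) chain of one-step reductions. A term is strongly normalizable if there is no infinite chain of one-step reductions starting from it. For $t$ of type $\sigma^*$, the surface elements $\mathrm{SM}(t)$ are: $\{q\}$ if $t=\mathfrak{s}q$; $\mathrm{SM}(q)\cup\mathrm{SM}(r)$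 if $t=\cup qr$; $\emptyset$ otherwise. Reducible terms $\mathrm{Red}_\sigma$ are defined by recursion on types: $t\in\mathrm{Red}_N$ iff $t$ is strongly normalizable; $t\in\mathrm{Red}_{\sigma\to\tau}$ iff $tq\in\mathrm{Red}_\tau$ for all $q\in\mathrm{Red}_\sigma$; $t\in\mathrm{Red}_{\sigma^*}$ iff $t$ is strongly normalizable and, for every term $t'$ with $t\succeq t'$, all surface elements of $t'$ are in $\mathrm{Red}_\sigma$. A term is reducible if it lies in $\mathrm{Red}_\sigma$ for its type $\sigma$. *)

theory Defs
  imports Main
begin

datatype ty =
    N
  | Fun ty ty  (infixr \<open>\<rightarrow>\<close> 65)
  | Star ty    (\<open>_\<^sup>\<star>\<close> [1000] 999)

datatype cst =
    Zero
  | Succ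
  | Rec ty
  | Proj ty ty          (* Pi *)
  | Subst ty ty ty      (* Sigma *)
  | Sing ty
  | Cup ty
  | BigCup ty ty

primrec cst_type :: "cst \<Rightarrow> ty" where
  "cst_type Zero = N"
| "cst_type Succ = N \<rightarrow> N"
| "cst_type (Rec \<sigma>) = N \<rightarrow> \<sigma> \<rightarrow> (\<sigma> \<rightarrow> N \<rightarrow> \<sigma>) \<rightarrow> \<sigma>"
| "cst_type (Proj \<sigma> \<tau>) = \<sigma> \<rightarrow> \<tau> \<rightarrow> \<sigma>"
| "cst_type (Subst \<rho> \<sigma> \<tau>) = (\<rho> \<rightarrow> \<sigma> \<rightarrow> \<tau>) \<rightarrow> (\<rho> \<rightarrow> \<sigma>) \<rightarrow> \<rho> \<rightarrow> \<tau>"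
| "cst_type (Sing \<sigma>) = \<sigma> \<rightarrow> \<sigma>\<^sup>\<star>"
| "cst_type (Cup \<sigma>) = \<sigma>\<^sup>\<star> \<rightarrow> \<sigma>\<^sup>\<star> \<rightarrow> \<sigma>\<^sup>\<star>"
| "cst_type (BigCup \<sigma> \<tau>) = \<sigma>\<^sup>\<star> \<rightarrow> (\<sigma> \<rightarrow> \<tau>\<^sup>\<star>) \<rightarrow> \<tau>\<^sup>\<star>"

text \<open>
  Raw terms carry type annotations on constants and variables but need not be well typed;
  the terms of the calculus are those \<open>t\<close> with \<open>has_type t \<sigma>\<close> for some (unique) \<open>\<sigma>\<close>.
  \<open>Var i \<sigma>\<close> is the \<open>i\<close>-th variable of type \<open>\<sigma>\<close>.
\<close>

datatype trm =
    Cst cst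
  | Var nat ty
  | App trm trm  (infixl \<open>\<cdot>\<close> 100)

inductive has_type :: "trm \<Rightarrow> ty \<Rightarrow> bool" where
  Cst: "has_type (Cst c) (cst_type c)"
| Var: "has_type (Var i \<sigma>) \<sigma>"
| App: "has_type t (\<sigma> \<rightarrow> \<tau>) \<Longrightarrow> has_type q \<sigma> \<Longrightarrow> has_type (t \<cdot> q) \<tau>"

text \<open>
  In the union rules the type indices on the left-hand side are the only ones for which it
  is well typed.
\<close>

inductive conv :: "trm \<Rightarrow> trm \<Rightarrow> bool" where
  Subst: "conv (Cst (Subst \<rho> \<sigma> \<tau>) \<cdot> t \<cdot> q \<cdot> r) (t \<cdot> r \<cdot> (q \<cdot> r))"
| Proj: "conv (Cst (Proj \<sigma> \<tau>) \<cdot> t \<cdot> q) t"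
| BigCup_Sing: "conv (Cst (BigCup \<sigma> \<tau>) \<cdot> (Cst (Sing \<sigma>) \<cdot> t) \<cdot> q) (q \<cdot> t)"
| BigCup_Cup: "conv (Cst (BigCup \<sigma> \<tau>) \<cdot> (Cst (Cup \<sigma>) \<cdot> t \<cdot> q) \<cdot> r)
    (Cst (Cup \<tau>) \<cdot> (Cst (BigCup \<sigma> \<tau>) \<cdot> t \<cdot> r) \<cdot> (Cst (BigCup \<sigma> \<tau>) \<cdot> q \<cdot> r))"
| Rec_Zero: "conv (Cst (Rec \<sigma>) \<cdot> Cst Zero \<cdot> q \<cdot> r) q"
| Rec_Succ: "conv (Cst (Rec \<sigma>) \<cdot> (Cst Succ \<cdot> t) \<cdot> q \<cdot> r)
    (r \<cdot> (Cst (Rec \<sigma>) \<cdot> t \<cdot> q \<cdot> r) \<cdot> t)"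

inductive step :: "trm \<Rightarrow> trm \<Rightarrow> bool"  (infix \<open>\<succ>\<^sub>1\<close> 50) where
  conv: "conv t q \<Longrightarrow> t \<succ>\<^sub>1 q"
| AppL: "t \<succ>\<^sub>1 t' \<Longrightarrow> t \<cdot> q \<succ>\<^sub>1 t' \<cdot> q"
| AppR: "q \<succ>\<^sub>1 q' \<Longrightarrow> t \<cdot> q \<succ>\<^sub>1 t \<cdot> q'"

abbreviation steps :: "trm \<Rightarrow> trm \<Rightarrow> bool"  (infix \<open>\<succeq>\<close> 50) where
  "t \<succeq> q \<equiv> step\<^sup>*\<^sup>* t q"

definition strongly_normalizable :: "trm \<Rightarrow> bool" where
  "strongly_normalizable t \<longleftrightarrow> \<not> (\<exists>f :: nat \<Rightarrow> trm. f 0 = t \<and> (\<forall>i. f i \<succ>\<^sub>1 f (Suc i)))"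

fun SM :: "trm \<Rightarrow> trm set" where
  "SM (Cst (Sing \<sigma>) \<cdot> q) = {q}"
| "SM (Cst (Cup \<sigma>) \<cdot> q \<cdot> r) = SM q \<union> SM r"
| "SM _ = {}"

primrec Red :: "ty \<Rightarrow> trm set" where
  "Red N = {t. has_type t N \<and> strongly_normalizable t}"
| "Red (\<sigma> \<rightarrow> \<tau>) = {t. has_type t (\<sigma> \<rightarrow> \<tau>) \<and> (\<forall>q \<in> Red \<sigma>. t \<cdot> q \<in> Red \<tau>)}"
| "Red (\<sigma>\<^sup>\<star>) = {t. has_type t (\<sigma>\<^sup>\<star>) \<and> strongly_normalizable t \<and>
     (\<forall>t'. t \<succeq> t' \<longrightarrow> SM t' \<subseteq> Red \<sigma>)}"

inductive_cases has_type_CstE: "has_type (Cst c) \<sigma>"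
inductive_cases has_type_VarE: "has_type (Var i \<tau>) \<sigma>"
inductive_cases has_type_AppE: "has_type (t \<cdot> q) \<tau>"

lemma has_type_unique: "has_type t \<sigma> \<Longrightarrow> has_type t \<tau> \<Longrightarrow> \<sigma> = \<tau>"
  by (induction arbitrary: \<tau> rule: has_type.induct)
    (blast elim: has_type_CstE has_type_VarE has_type_AppE)+

lemma conv_has_type: "conv t q \<Longrightarrow> has_type t \<sigma> \<Longrightarrow> has_type q \<sigma>"
  by (induction rule: conv.induct)
    (fastforce elim!: has_type_AppE has_type_CstE intro: has_type.intros
       has_type.Cst[of "Cup _", simplified] has_type.Cst[of "BigCup _ _", simplified]
       has_type.Cst[of "Rec _", simplified])+

lemma step_has_type: "t \<succ>\<^sub>1 q \<Longrightarrow> has_type t \<sigma> \<Longrightarrow> has_type q \<sigma>"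
  by (induction arbitrary: \<sigma> rule: step.induct)
    (blast intro: conv_has_type has_type.App elim: has_type_AppE)+

end

theory Submission
  imports Defs
begin

text \<open>
  The proof is Tait's method with reducibility candidates. Every \<open>Red \<sigma>\<close> consists of strongly
  normalizable terms, is closed under reduction, and contains each neutral term all of whose
  one-step reducts it contains. Each constant is then shown to be reducible. The conversions of
  \<open>BigCup\<close> on \<open>Cup\<close> and of \<open>Rec\<close> on \<open>Succ\<close> recur on proper subterms of an argument rather than on
  reducts, so these two cases use induction along the union of reduction and the subterm
  relation, which is well founded below a strongly normalizable term because reducing a subterm
  reduces the whole term.
\<close>

section \<open>Strong normalizability\<close>

lemma strongly_normalizableI:
  assumes "\<And>t'. t \<succ>\<^sub>1 t' \<Longrightarrow> strongly_normalizable t'"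
  shows "strongly_normalizable t"
  unfolding strongly_normalizable_def
proof clarify
  fix f assume "t = f 0" "\<forall>i. f i \<succ>\<^sub>1 f (Suc i)"
  then have "\<not> strongly_normalizable (f (Suc 0))" "t \<succ>\<^sub>1 f (Suc 0)"
    unfolding strongly_normalizable_def by (auto intro!: exI[of _ "\<lambda>i. f (Suc i)"])
  with assms show False by blast
qed

lemma strongly_normalizable_step:
  assumes "strongly_normalizable t" "t \<succ>\<^sub>1 t'"
  shows "strongly_normalizable t'"
  unfolding strongly_normalizable_def
proof clarify
  fix f assume "t' = f 0" "\<forall>i. f i \<succ>\<^sub>1 f (Suc i)"
  \<comment> \<open>\<open>case_nat t f\<close> is the chain \<open>f\<close> with \<open>t\<close>
    put in front of it.\<close>
  then have "\<forall>i. case_nat t f i \<succ>\<^sub>1 case_nat t f (Suc i)"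
    using assms(2) by (auto split: nat.split)
  with assms(1) show False
    unfolding strongly_normalizable_def by (metis nat.case(1))
qed

text \<open>Turns the absence of infinite chains into well-founded induction: a strongly
  normalizable counterexample would have a reduct that is again one, and dependent choice would
  string these into an infinite chain.\<close>

lemma strongly_normalizable_induct [consumes 1, case_names SN]:
  assumes "strongly_normalizable t"
    and step: "\<And>t. strongly_normalizable t \<Longrightarrow> (\<And>t'. t \<succ>\<^sub>1 t' \<Longrightarrow> P t') \<Longrightarrow> P t"
  shows "P t"
proof (rule ccontr)
  assume "\<not> P t"
  define B where "B u \<longleftrightarrow> strongly_normalizable u \<and> \<not> P u" for u
  have "\<exists>v. B v \<and> u \<succ>\<^sub>1 v" if "B u" for u
    using that step strongly_normalizable_step unfolding B_def by blast
  moreover have "B t"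
    using assms(1) \<open>\<not> P t\<close> by (simp add: B_def)
  ultimately obtain f where "f 0 = t" "\<forall>i. f i \<succ>\<^sub>1 f (Suc i)"
    \<comment> \<open>The clause for \<open>n = 0\<close> pins the start of the chosen chain to
      \<open>t\<close>.\<close>
    using dependent_nat_choice[of "\<lambda>n u. B u \<and> (n = 0 \<longrightarrow> u = t)" "\<lambda>_. step"] by auto
  with assms(1) show False
    unfolding strongly_normalizable_def by blast
qed

text \<open>An infinite chain in either component becomes one of the whole application by keeping
  the other component fixed.\<close>

lemma strongly_normalizable_AppD:
  assumes "strongly_normalizable (t \<cdot> q)"
  shows "strongly_normalizable t" "strongly_normalizable q"
proof -
  show "strongly_normalizable t"
    unfolding strongly_normalizable_def
  proof clarify
    fix f assume "t = f 0" "\<forall>i. f i \<succ>\<^sub>1 f (Suc i)"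
    with assms show False
      unfolding strongly_normalizable_def
      by (auto intro: step.AppL dest!: spec[of _ "\<lambda>i. f i \<cdot> q"])
  qed
  show "strongly_normalizable q"
    unfolding strongly_normalizable_def
  proof clarify
    fix f assume "q = f 0" "\<forall>i. f i \<succ>\<^sub>1 f (Suc i)"
    with assms show False
      unfolding strongly_normalizable_def
      by (auto intro: step.AppR dest!: spec[of _ "\<lambda>i. t \<cdot> f i"])
  qed
qed

section \<open>Subterms and induction along reducts and subterms\<close>

inductive subterm :: "trm \<Rightarrow> trm \<Rightarrow> bool" where
  refl: "subterm t t"
| AppL: "subterm s t \<Longrightarrow> subterm s (t \<cdot> q)"
| AppR: "subterm s q \<Longrightarrow> subterm s (t \<cdot> q)"

lemma subterm_trans: "subterm s t \<Longrightarrow> subterm r s \<Longrightarrow> subterm r t"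
  by (induction rule: subterm.induct) (auto intro: subterm.intros)

lemma subterm_step: "subterm s t \<Longrightarrow> s \<succ>\<^sub>1 s' \<Longrightarrow> \<exists>t'. t \<succ>\<^sub>1 t' \<and> subterm s' t'"
  by (induction rule: subterm.induct) (blast intro: subterm.intros step.intros)+

lemma strongly_normalizable_subterm:
  "subterm s t \<Longrightarrow> strongly_normalizable t \<Longrightarrow> strongly_normalizable s"
  by (induction rule: subterm.induct) (auto dest: strongly_normalizable_AppD)

text \<open>The outer induction on reducts of \<open>t\<close> is strengthened to all subterms of
  \<open>t\<close>; the inner one is on the size of the subterm \<open>s\<close>. A reduct of
  \<open>s\<close> is a subterm of a reduct of \<open>t\<close>, so the outer hypothesis covers it,
  and smaller subterms of \<open>s\<close> fall under the inner one.\<close>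

lemma strongly_normalizable_subterm_induct [consumes 1, case_names SN]:
  assumes "strongly_normalizable t"
    and step: "\<And>t. strongly_normalizable t \<Longrightarrow> (\<And>t'. t \<succ>\<^sub>1 t' \<Longrightarrow> P t') \<Longrightarrow>
      (\<And>s. subterm s t \<Longrightarrow> size s < size t \<Longrightarrow> P s) \<Longrightarrow> P t"
  shows "P t"
proof -
  have "\<forall>s. subterm s t \<longrightarrow> P s"
    using assms(1)
  proof (induction rule: strongly_normalizable_induct)
    case (SN t)
    have "P s" if "subterm s t" for s
      using that
    proof (induction s rule: measure_induct_rule[of size])
      case (less s)
      show ?case
      proof (rule step)
        show "strongly_normalizable s"
          using less.prems SN.hyps strongly_normalizable_subterm by blast
        show "P u" if "s \<succ>\<^sub>1 u" for u
          using subterm_step[OF less.prems that] SN.IH by blast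
        show "P r" if "subterm r s" "size r < size s" for r
          using less subterm_trans that by blast
      qed
    qed
    then show ?case by blast
  qed
  then show ?thesis by (blast intro: subterm.refl)
qed

section \<open>Reducibility candidates\<close>

text \<open>Neutral terms form no redex with further arguments and have no surface elements.\<close>

inductive neutral :: "trm \<Rightarrow> bool" where
  Var: "neutral (Var i \<sigma>)"
| Subst: "neutral (Cst (Subst \<rho> \<sigma> \<tau>) \<cdot> t \<cdot> q \<cdot> r)"
| Proj: "neutral (Cst (Proj \<sigma> \<tau>) \<cdot> t \<cdot> q)"
| BigCup: "neutral (Cst (BigCup \<sigma> \<tau>) \<cdot> t \<cdot> q)"
| Rec: "neutral (Cst (Rec \<sigma>) \<cdot> t \<cdot> q \<cdot> r)"
| App: "neutral t \<Longrightarrow> neutral (t \<cdot> q)"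

inductive_cases neutral_CstE: "neutral (Cst c)"
inductive_cases neutral_AppE: "neutral (t \<cdot> q)"
inductive_cases step_CstE: "Cst c \<succ>\<^sub>1 u"
inductive_cases step_VarE: "Var i \<sigma> \<succ>\<^sub>1 u"
inductive_cases step_AppE: "t \<cdot> q \<succ>\<^sub>1 u"
inductive_cases conv_CstE: "conv (Cst c) u"
inductive_cases conv_VarE: "conv (Var i \<sigma>) u"

lemma not_Cst_step: "Cst c \<succ>\<^sub>1 u \<Longrightarrow> False"
  by (blast elim: step_CstE conv_CstE)

lemma not_Var_step: "Var i \<sigma> \<succ>\<^sub>1 u \<Longrightarrow> False"
  by (blast elim: step_VarE conv_VarE)

text \<open>The function part of a redex is a constant lacking exactly one argument, whereas neutral
  terms have a variable or an already saturated constant at the head.\<close>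

lemma neutral_not_conv: "neutral t \<Longrightarrow> \<not> conv (t \<cdot> q) u"
  by (auto elim!: conv.cases neutral_AppE neutral_CstE)

lemma neutral_SM: "neutral t \<Longrightarrow> SM t = {}"
  by (cases t rule: SM.cases) (auto elim: neutral_AppE neutral_CstE)

lemma Red_has_type: "t \<in> Red \<sigma> \<Longrightarrow> has_type t \<sigma>"
  by (cases \<sigma>) auto

text \<open>The properties are proved together because the function case mixes them: the neutral
  clause at the argument type supplies a variable to apply to, and strong normalizability of
  arguments drives the induction for neutral terms.\<close>

lemma Red_candidate:
  "(\<forall>t \<in> Red \<sigma>. strongly_normalizable t \<and> (\<forall>t'. t \<succ>\<^sub>1 t' \<longrightarrow> t' \<in> Red \<sigma>)) \<and>
   (\<forall>t. has_type t \<sigma> \<longrightarrow> neutral t \<longrightarrow> (\<forall>t'. t \<succ>\<^sub>1 t' \<longrightarrow> t' \<in> Red \<sigma>) \<longrightarrow> t \<in> Red \<sigma>)"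
proof (induction \<sigma>)
  case N
  show ?case
    by (auto intro: strongly_normalizableI strongly_normalizable_step step_has_type)
next
  case (Fun \<sigma> \<tau>)
  \<comment> \<open>A variable is neutral without reducts. Applying a reducible \<open>t\<close> to
    it gives a reducible, hence strongly normalizable, term, and \<open>t\<close> is its left
    component.\<close>
  have "Var 0 \<sigma> \<in> Red \<sigma>"
    using Fun.IH(1) by (blast intro: has_type.Var neutral.Var dest: not_Var_step)
  then have SN: "strongly_normalizable t" if "t \<in> Red (\<sigma> \<rightarrow> \<tau>)" for t
    using that Fun.IH(2) strongly_normalizable_AppD(1) by auto
  have closed: "t' \<in> Red (\<sigma> \<rightarrow> \<tau>)" if "t \<in> Red (\<sigma> \<rightarrow> \<tau>)" "t \<succ>\<^sub>1 t'" for t t'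
    using that Fun.IH(2) by (auto intro: step_has_type step.AppL)
  have "t \<cdot> q \<in> Red \<tau>"
    if t: "has_type t (\<sigma> \<rightarrow> \<tau>)" "neutral t" "\<forall>t'. t \<succ>\<^sub>1 t' \<longrightarrow> t' \<in> Red (\<sigma> \<rightarrow> \<tau>)"
      and q: "q \<in> Red \<sigma>" for t q
  proof -
    have "strongly_normalizable q"
      using q Fun.IH(1) by blast
    then show ?thesis
      using q
    \<comment> \<open>Since \<open>t\<close> is neutral, \<open>t \<cdot> q\<close> is no redex; a
      step is either in \<open>t\<close>, covered by the assumption on \<open>t\<close>, or in
      \<open>q\<close>, covered by induction.\<close>
    proof (induction rule: strongly_normalizable_induct)
      case (SN q)
      have "u \<in> Red \<tau>" if "t \<cdot> q \<succ>\<^sub>1 u" for u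
        using that
      proof cases
        case conv
        then show ?thesis using neutral_not_conv t(2) by blast
      next
        case (AppL t')
        then show ?thesis using t(3) SN.prems by auto
      next
        case (AppR q')
        then show ?thesis using SN Fun.IH(1) by blast
      qed
      moreover have "has_type (t \<cdot> q) \<tau>"
        using t(1) SN.prems by (blast intro: has_type.App Red_has_type)
      ultimately show ?case
        using Fun.IH(2) t(2) by (blast intro: neutral.App)
    qed
  qed
  then have "t \<in> Red (\<sigma> \<rightarrow> \<tau>)"
    if "has_type t (\<sigma> \<rightarrow> \<tau>)" "neutral t" "\<forall>t'. t \<succ>\<^sub>1 t' \<longrightarrow> t' \<in> Red (\<sigma> \<rightarrow> \<tau>)" for t
    using that by (subst Red.simps(2)) blast
  with SN closed show ?case
    by blast
next
  case (Star \<sigma>)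
  have "t \<in> Red (\<sigma>\<^sup>\<star>)"
    if t: "has_type t (\<sigma>\<^sup>\<star>)" "neutral t" "\<forall>t'. t \<succ>\<^sub>1 t' \<longrightarrow> t' \<in> Red (\<sigma>\<^sup>\<star>)" for t
  proof -
    \<comment> \<open>An empty chain ends in the neutral \<open>t\<close>, which has no surface
      elements; any other chain passes through a first reduct, which is reducible by
      assumption.\<close>
    have "SM u \<subseteq> Red \<sigma>" if "t \<succeq> u" for u
      using that
    proof (cases rule: converse_rtranclpE)
      case base
      then show ?thesis using neutral_SM t(2) by blast
    next
      case (step t')
      then show ?thesis using t(3) by auto
    qed
    then show ?thesis
      using t(1,3) by (auto intro: strongly_normalizableI)
  qed
  then show ?case
    by (auto intro: strongly_normalizable_step step_has_type converse_rtranclp_into_rtranclp)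
qed

lemma Red_strongly_normalizable: "t \<in> Red \<sigma> \<Longrightarrow> strongly_normalizable t"
  using Red_candidate by blast

lemma Red_step: "t \<in> Red \<sigma> \<Longrightarrow> t \<succ>\<^sub>1 t' \<Longrightarrow> t' \<in> Red \<sigma>"
  using Red_candidate by blast

lemma Red_neutralI:
  "has_type t \<sigma> \<Longrightarrow> neutral t \<Longrightarrow> (\<And>t'. t \<succ>\<^sub>1 t' \<Longrightarrow> t' \<in> Red \<sigma>) \<Longrightarrow> t \<in> Red \<sigma>"
  using Red_candidate by blast

lemma Red_App: "t \<in> Red (\<sigma> \<rightarrow> \<tau>) \<Longrightarrow> q \<in> Red \<sigma> \<Longrightarrow> t \<cdot> q \<in> Red \<tau>"
  by simp

lemma Red_Var: "Var i \<sigma> \<in> Red \<sigma>"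
  by (rule Red_neutralI) (auto intro: has_type.Var neutral.Var dest: not_Var_step)

section \<open>Reducibility of the constants\<close>

lemma has_type_Cst_App:
  "cst_type c = \<sigma> \<rightarrow> \<tau> \<Longrightarrow> has_type a \<sigma> \<Longrightarrow> has_type (Cst c \<cdot> a) \<tau>"
  using has_type.Cst[of c] has_type.App by simp

lemma step_Cst_App1:
  assumes "Cst c \<cdot> a \<succ>\<^sub>1 u"
  obtains a' where "u = Cst c \<cdot> a'" "a \<succ>\<^sub>1 a'"
  using assms by (auto elim!: step_AppE conv.cases dest: not_Cst_step)

lemma step_Cst_App2:
  assumes "Cst c \<cdot> a \<cdot> b \<succ>\<^sub>1 u"
  obtains "conv (Cst c \<cdot> a \<cdot> b) u"
  | a' where "u = Cst c \<cdot> a' \<cdot> b" "a \<succ>\<^sub>1 a'"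
  | b' where "u = Cst c \<cdot> a \<cdot> b'" "b \<succ>\<^sub>1 b'"
  using assms by (auto elim!: step_AppE[of "Cst c \<cdot> a"] step_Cst_App1)

text \<open>The second assumption excludes a conversion of the prefix, as \<open>Proj\<close> and
  \<open>BigCup\<close> would allow. It holds for \<open>Subst\<close> and \<open>Rec\<close>, whose
  conversions take three arguments.\<close>

lemma step_Cst_App3 [consumes 1, case_names no_conv 1 2 3 4]:
  assumes "Cst c \<cdot> a \<cdot> b \<cdot> d \<succ>\<^sub>1 u" "\<And>v. \<not> conv (Cst c \<cdot> a \<cdot> b) v"
  obtains "conv (Cst c \<cdot> a \<cdot> b \<cdot> d) u"
  | a' where "u = Cst c \<cdot> a' \<cdot> b \<cdot> d" "a \<succ>\<^sub>1 a'"
  | b' where "u = Cst c \<cdot> a \<cdot> b' \<cdot> d" "b \<succ>\<^sub>1 b'"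
  | d' where "u = Cst c \<cdot> a \<cdot> b \<cdot> d'" "d \<succ>\<^sub>1 d'"
  using assms by (auto elim!: step_AppE[of "Cst c \<cdot> a \<cdot> b"] step_Cst_App2)

section \<open>Numerals and the combinators\<close>

lemma Red_Zero: "Cst Zero \<in> Red N"
  using has_type.Cst[of Zero]
  by (auto intro: strongly_normalizableI dest: not_Cst_step)

lemma Red_Succ_App:
  assumes "t \<in> Red N"
  shows "Cst Succ \<cdot> t \<in> Red N"
proof -
  have "strongly_normalizable t"
    using assms by simp
  then have "strongly_normalizable (Cst Succ \<cdot> t)"
    by (induction rule: strongly_normalizable_induct)
      (blast intro: strongly_normalizableI elim: step_Cst_App1)
  then show ?thesis
    using assms by (auto intro: has_type_Cst_App)
qed

text \<open>Pattern for \<open>Subst\<close>, \<open>BigCup\<close> and \<open>Rec\<close> as well: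
  the saturated application is neutral, so only its reducts matter. Steps inside an argument are
  handled by nested inductions, one per argument, and the conversion at the root is treated
  directly.\<close>

lemma Red_Proj_App:
  assumes "t \<in> Red \<sigma>" "q \<in> Red \<tau>"
  shows "Cst (Proj \<sigma> \<tau>) \<cdot> t \<cdot> q \<in> Red \<sigma>"
  using Red_strongly_normalizable[OF assms(1)] assms
proof (induction arbitrary: q rule: strongly_normalizable_induct)
  case t: (SN t)
  show ?case
    using Red_strongly_normalizable[OF t.prems(2)] t.prems
  proof (induction rule: strongly_normalizable_induct)
    case q: (SN q)
    show ?case
    proof (rule Red_neutralI)
      show "has_type (Cst (Proj \<sigma> \<tau>) \<cdot> t \<cdot> q) \<sigma>"
        using q.prems by (auto intro!: has_type.App has_type_Cst_App dest: Red_has_type)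
      show "u \<in> Red \<sigma>" if "Cst (Proj \<sigma> \<tau>) \<cdot> t \<cdot> q \<succ>\<^sub>1 u" for u
        using that
      proof (cases rule: step_Cst_App2)
        case 1
        then show ?thesis using q.prems by cases auto
      next
        case (2 t')
        then show ?thesis using t.IH q.prems Red_step by blast
      next
        case (3 q')
        then show ?thesis using q.IH q.prems Red_step by blast
      qed
    qed (rule neutral.Proj)
  qed
qed

lemma Red_Subst_App:
  assumes "t \<in> Red (\<rho> \<rightarrow> \<sigma> \<rightarrow> \<tau>)" "q \<in> Red (\<rho> \<rightarrow> \<sigma>)" "r \<in> Red \<rho>"
  shows "Cst (Subst \<rho> \<sigma> \<tau>) \<cdot> t \<cdot> q \<cdot> r \<in> Red \<tau>"
  using Red_strongly_normalizable[OF assms(1)] assms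
proof (induction arbitrary: q r rule: strongly_normalizable_induct)
  case t: (SN t)
  show ?case
    using Red_strongly_normalizable[OF t.prems(2)] t.prems
  proof (induction arbitrary: r rule: strongly_normalizable_induct)
    case q: (SN q)
    show ?case
      using Red_strongly_normalizable[OF q.prems(3)] q.prems
    proof (induction rule: strongly_normalizable_induct)
      case r: (SN r)
      show ?case
      proof (rule Red_neutralI)
        show "has_type (Cst (Subst \<rho> \<sigma> \<tau>) \<cdot> t \<cdot> q \<cdot> r) \<tau>"
          by (rule has_type.App has_type_Cst_App Red_has_type r.prems cst_type.simps)+
        show "u \<in> Red \<tau>" if "Cst (Subst \<rho> \<sigma> \<tau>) \<cdot> t \<cdot> q \<cdot> r \<succ>\<^sub>1 u" for u
          using that
        proof (cases rule: step_Cst_App3)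
          case 1
          then show ?thesis using r.prems by cases (blast intro: Red_App)
        next
          case (2 t')
          then show ?thesis using t.IH r.prems Red_step by blast
        next
          case (3 q')
          then show ?thesis using q.IH r.prems Red_step by blast
        next
          case (4 r')
          then show ?thesis using r.IH r.prems Red_step by blast
        qed (auto elim: conv.cases)
      qed (rule neutral.Subst)
    qed
  qed
qed

section \<open>Constructors of star types\<close>

lemma Red_Sing_App:
  assumes "t \<in> Red \<sigma>"
  shows "Cst (Sing \<sigma>) \<cdot> t \<in> Red (\<sigma>\<^sup>\<star>)"
proof -
  have "strongly_normalizable (Cst (Sing \<sigma>) \<cdot> t)"
    using Red_strongly_normalizable[OF assms]
    by (induction rule: strongly_normalizable_induct)
      (blast intro: strongly_normalizableI elim: step_Cst_App1)
  \<comment> \<open>\<open>Sing\<close> heads no conversion, so reduction happens only inside its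
    argument, and the sole surface element of a reduct is a reduct of \<open>t\<close>.\<close>
  moreover have "\<exists>t'. u = Cst (Sing \<sigma>) \<cdot> t' \<and> t' \<in> Red \<sigma>" if "Cst (Sing \<sigma>) \<cdot> t \<succeq> u" for u
    using that by (induction rule: rtranclp_induct)
      (use assms in \<open>auto elim!: step_Cst_App1 intro: Red_step\<close>)
  moreover have "has_type (Cst (Sing \<sigma>) \<cdot> t) (\<sigma>\<^sup>\<star>)"
    using assms by (auto intro: has_type_Cst_App Red_has_type)
  ultimately show ?thesis
    by fastforce
qed

lemma step_Cup_App:
  assumes "Cst (Cup \<sigma>) \<cdot> a \<cdot> b \<succ>\<^sub>1 u"
  obtains a' where "u = Cst (Cup \<sigma>) \<cdot> a' \<cdot> b" "a \<succ>\<^sub>1 a'"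
  | b' where "u = Cst (Cup \<sigma>) \<cdot> a \<cdot> b'" "b \<succ>\<^sub>1 b'"
  using assms by (auto elim!: step_Cst_App2 elim: conv.cases)

text \<open>\<open>Cup\<close> heads no conversion either, so its two arguments reduce independently
  and each surface element of a reduct belongs to a reduct of \<open>a\<close> or of
  \<open>b\<close>.\<close>

lemma Red_Cup_App:
  assumes "a \<in> Red (\<sigma>\<^sup>\<star>)" "b \<in> Red (\<sigma>\<^sup>\<star>)"
  shows "Cst (Cup \<sigma>) \<cdot> a \<cdot> b \<in> Red (\<sigma>\<^sup>\<star>)"
proof -
  have "strongly_normalizable (Cst (Cup \<sigma>) \<cdot> a \<cdot> b)"
    using Red_strongly_normalizable[OF assms(1)] Red_strongly_normalizable[OF assms(2)]
  proof (induction arbitrary: b rule: strongly_normalizable_induct)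
    case a: (SN a)
    show ?case
      using a.prems
      by (induction rule: strongly_normalizable_induct)
        (blast intro: strongly_normalizableI a.IH elim: step_Cup_App)
  qed
  moreover have "\<exists>a' b'. u = Cst (Cup \<sigma>) \<cdot> a' \<cdot> b' \<and> a \<succeq> a' \<and> b \<succeq> b'"
    if "Cst (Cup \<sigma>) \<cdot> a \<cdot> b \<succeq> u" for u
    using that by (induction rule: rtranclp_induct)
      (auto elim!: step_Cup_App intro: rtranclp.rtrancl_into_rtrancl)
  moreover have "has_type (Cst (Cup \<sigma>) \<cdot> a \<cdot> b) (\<sigma>\<^sup>\<star>)"
    by (rule has_type.App has_type_Cst_App Red_has_type assms cst_type.simps)+
  ultimately show ?thesis
    using assms by fastforce
qed

lemma Red_Sing_AppD: "Cst (Sing \<sigma>) \<cdot> t \<in> Red (\<sigma>\<^sup>\<star>) \<Longrightarrow> t \<in> Red \<sigma>"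
  by fastforce

text \<open>Supplies the reducibility of the pieces on which \<open>BigCup\<close> recurs.
  Reductions of one argument lift to the union, whose surface elements include those of that
  argument.\<close>

lemma Red_Cup_AppD:
  assumes "Cst (Cup \<sigma>) \<cdot> a \<cdot> b \<in> Red (\<sigma>\<^sup>\<star>)"
  shows "a \<in> Red (\<sigma>\<^sup>\<star>)" "b \<in> Red (\<sigma>\<^sup>\<star>)"
proof -
  have "has_type a (\<sigma>\<^sup>\<star>)" "has_type b (\<sigma>\<^sup>\<star>)"
    using Red_has_type[OF assms] by (auto elim!: has_type_AppE has_type_CstE)
  moreover have "strongly_normalizable a" "strongly_normalizable b"
    using Red_strongly_normalizable[OF assms] strongly_normalizable_AppD by blast+
  moreover have "Cst (Cup \<sigma>) \<cdot> a \<cdot> b \<succeq> Cst (Cup \<sigma>) \<cdot> a' \<cdot> b" if "a \<succeq> a'" for a'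
    using that by (induction rule: rtranclp_induct)
      (auto intro: rtranclp.rtrancl_into_rtrancl step.AppL step.AppR)
  moreover have "Cst (Cup \<sigma>) \<cdot> a \<cdot> b \<succeq> Cst (Cup \<sigma>) \<cdot> a \<cdot> b'" if "b \<succeq> b'" for b'
    using that by (induction rule: rtranclp_induct)
      (auto intro: rtranclp.rtrancl_into_rtrancl step.AppR)
  ultimately show "a \<in> Red (\<sigma>\<^sup>\<star>)" "b \<in> Red (\<sigma>\<^sup>\<star>)"
    using assms by fastforce+
qed

section \<open>The constants that recur on subterms\<close>

lemma Red_BigCup_App:
  assumes "f \<in> Red (\<sigma> \<rightarrow> \<tau>\<^sup>\<star>)" "a \<in> Red (\<sigma>\<^sup>\<star>)"
  shows "Cst (BigCup \<sigma> \<tau>) \<cdot> a \<cdot> f \<in> Red (\<tau>\<^sup>\<star>)"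
  using Red_strongly_normalizable[OF assms(1)] assms
proof (induction arbitrary: a rule: strongly_normalizable_induct)
  case f: (SN f)
  show ?case
    using Red_strongly_normalizable[OF f.prems(2)] f.prems
  \<comment> \<open>The argument recurred on comes innermost, because the recursive calls created by
    the conversion keep \<open>f\<close> unchanged.\<close>
  proof (induction rule: strongly_normalizable_subterm_induct)
    case a: (SN a)
    show ?case
    proof (rule Red_neutralI)
      show "has_type (Cst (BigCup \<sigma> \<tau>) \<cdot> a \<cdot> f) (\<tau>\<^sup>\<star>)"
        by (rule has_type.App has_type_Cst_App Red_has_type a.prems cst_type.simps)+
      show "u \<in> Red (\<tau>\<^sup>\<star>)" if "Cst (BigCup \<sigma> \<tau>) \<cdot> a \<cdot> f \<succ>\<^sub>1 u" for u
        using that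
      proof (cases rule: step_Cst_App2)
        case 1
        then show ?thesis
        proof cases
          case (BigCup_Sing t)
          then show ?thesis
            using a.prems Red_Sing_AppD Red_App by blast
        next
          case (BigCup_Cup b c)
          have "b \<in> Red (\<sigma>\<^sup>\<star>)" "c \<in> Red (\<sigma>\<^sup>\<star>)"
            using a.prems(2) Red_Cup_AppD unfolding BigCup_Cup by blast+
          then have "Cst (BigCup \<sigma> \<tau>) \<cdot> b \<cdot> f \<in> Red (\<tau>\<^sup>\<star>)" "Cst (BigCup \<sigma> \<tau>) \<cdot> c \<cdot> f \<in> Red (\<tau>\<^sup>\<star>)"
            \<comment> \<open>Here \<open>a\<close> is the union of \<open>b\<close> and
              \<open>c\<close>, which are smaller subterms of it but need not be reducts, so the
              subterm hypothesis is the one that applies.\<close>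
            using a.IH(2)[of b] a.IH(2)[of c] a.prems(1) unfolding BigCup_Cup
            by (auto simp del: Red.simps intro: subterm.intros)
          then show ?thesis
            unfolding BigCup_Cup by (rule Red_Cup_App)
        qed
      next
        case (2 a')
        then show ?thesis using a.IH(1) a.prems Red_step by blast
      next
        case (3 f')
        then show ?thesis using f.IH a.prems Red_step by blast
      qed
    qed (rule neutral.BigCup)
  qed
qed

lemma Red_Rec_App:
  assumes "q \<in> Red \<sigma>" "r \<in> Red (\<sigma> \<rightarrow> N \<rightarrow> \<sigma>)" "t \<in> Red N"
  shows "Cst (Rec \<sigma>) \<cdot> t \<cdot> q \<cdot> r \<in> Red \<sigma>"
  using Red_strongly_normalizable[OF assms(1)] assms
proof (induction arbitrary: r t rule: strongly_normalizable_induct)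
  case q: (SN q)
  show ?case
    using Red_strongly_normalizable[OF q.prems(2)] q.prems
  proof (induction arbitrary: t rule: strongly_normalizable_induct)
    case r: (SN r)
    show ?case
      using Red_strongly_normalizable[OF r.prems(3)] r.prems
    proof (induction rule: strongly_normalizable_subterm_induct)
      case t: (SN t)
      show ?case
      proof (rule Red_neutralI)
        show "has_type (Cst (Rec \<sigma>) \<cdot> t \<cdot> q \<cdot> r) \<sigma>"
          by (rule has_type.App has_type_Cst_App Red_has_type t.prems cst_type.simps)+
        show "u \<in> Red \<sigma>" if "Cst (Rec \<sigma>) \<cdot> t \<cdot> q \<cdot> r \<succ>\<^sub>1 u" for u
          using that
        proof (cases rule: step_Cst_App3)
          case 1
          then show ?thesis
          proof cases
            case Rec_Zero
            then show ?thesis using t.prems by simp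
          next
            case (Rec_Succ s)
            \<comment> \<open>At the ground type reducibility is just typing and strong
              normalizability, and the predecessor \<open>s\<close> inherits both from
              \<open>t\<close>.\<close>
            have "has_type s N"
              using Red_has_type[OF t.prems(3)] unfolding Rec_Succ
              by (auto elim!: has_type_AppE has_type_CstE)
            moreover have "strongly_normalizable s"
              using t.hyps strongly_normalizable_AppD(2) unfolding Rec_Succ by blast
            ultimately have "s \<in> Red N"
              by simp
            moreover have "Cst (Rec \<sigma>) \<cdot> s \<cdot> q \<cdot> r \<in> Red \<sigma>"
              using t.IH(2)[of s] t.prems \<open>s \<in> Red N\<close> unfolding Rec_Succ
              by (auto simp del: Red.simps intro: subterm.intros)
            ultimately show ?thesis
              using t.prems(2) unfolding Rec_Succ by (blast intro: Red_App)
          qed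
        next
          case (2 t')
          then show ?thesis using t.IH(1) t.prems Red_step by blast
        next
          case (3 q')
          then show ?thesis using q.IH t.prems Red_step by blast
        next
          case (4 r')
          then show ?thesis using r.IH t.prems Red_step by blast
        qed (auto elim: conv.cases)
      qed (rule neutral.Rec)
    qed
  qed
qed

section \<open>From saturated applications to all terms\<close>

lemma Red_FunI:
  "has_type t (\<sigma> \<rightarrow> \<tau>) \<Longrightarrow> (\<And>q. q \<in> Red \<sigma> \<Longrightarrow> t \<cdot> q \<in> Red \<tau>) \<Longrightarrow> t \<in> Red (\<sigma> \<rightarrow> \<tau>)"
  by simp

lemma Red_FunI2:
  assumes "has_type t (\<rho> \<rightarrow> \<sigma> \<rightarrow> \<tau>)"
    and "\<And>p q. p \<in> Red \<rho> \<Longrightarrow> q \<in> Red \<sigma> \<Longrightarrow> t \<cdot> p \<cdot> q \<in> Red \<tau>"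
  shows "t \<in> Red (\<rho> \<rightarrow> \<sigma> \<rightarrow> \<tau>)"
  using assms by (blast intro: Red_FunI has_type.App Red_has_type)

lemma Red_FunI3:
  assumes "has_type t (\<pi> \<rightarrow> \<rho> \<rightarrow> \<sigma> \<rightarrow> \<tau>)"
    and "\<And>p q r. p \<in> Red \<pi> \<Longrightarrow> q \<in> Red \<rho> \<Longrightarrow> r \<in> Red \<sigma> \<Longrightarrow> t \<cdot> p \<cdot> q \<cdot> r \<in> Red \<tau>"
  shows "t \<in> Red (\<pi> \<rightarrow> \<rho> \<rightarrow> \<sigma> \<rightarrow> \<tau>)"
  using assms by (blast intro: Red_FunI2 Red_FunI has_type.App Red_has_type)

lemma Red_Cst: "Cst c \<in> Red (cst_type c)"
proof (cases c)
  case Zero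
  then show ?thesis
    using Red_Zero by simp
next
  case Succ
  then show ?thesis
    using has_type.Cst[of c] Red_Succ_App by (auto simp del: Red.simps intro!: Red_FunI)
next
  case (Rec \<sigma>)
  then show ?thesis
    using has_type.Cst[of c] Red_Rec_App by (auto simp del: Red.simps intro!: Red_FunI3)
next
  case (Proj \<sigma> \<tau>)
  then show ?thesis
    using has_type.Cst[of c] Red_Proj_App by (auto simp del: Red.simps intro!: Red_FunI2)
next
  case (Subst \<rho> \<sigma> \<tau>)
  then show ?thesis
    using has_type.Cst[of c] Red_Subst_App by (auto simp del: Red.simps intro!: Red_FunI3)
next
  case (Sing \<sigma>)
  then show ?thesis
    using has_type.Cst[of c] Red_Sing_App by (auto simp del: Red.simps intro!: Red_FunI)
next
  case (Cup \<sigma>)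
  then show ?thesis
    using has_type.Cst[of c] Red_Cup_App by (auto simp del: Red.simps intro!: Red_FunI2)
next
  case (BigCup \<sigma> \<tau>)
  then show ?thesis
    using has_type.Cst[of c] Red_BigCup_App by (auto simp del: Red.simps intro!: Red_FunI2)
qed

theorem theorem8:
  fixes t :: trm and \<sigma> :: ty
  assumes "has_type t \<sigma>"
  shows "t \<in> Red \<sigma>"
  using assms
  by (induction rule: has_type.induct) (blast intro: Red_Cst Red_Var Red_App)+

end
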